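(* Consider a graph-based Markov decision process with $n$ agents, influence graph $(\mathcal V,\mathcal E)$, and a joint policy $\pi$. Let $\gamma\in(0,1)$ and $\Gamma=\gamma\,\mathbb A D^{-1}\in\mathbb R^{n\times n}$. Let $\mathcal T^\pi$ be the Bellman operator on functions $V:\mathcal S\to\mathbb R^n$ given by $$(\mathcal T^\pi V)(S)=\Gamma\,\mathbb E_\pi\big[R^t+V(S^{t+1})\mid S^t=S\big].$$ Since $\|\Gamma\|_1=\max_j\sum_i\Gamma_{ij}=\gamma<1$, the operator $\mathcal T^\pi$ is a contraction on the space of bounded functions $V:\mathcal S\to\mathbb R^n$ under the norm $\|V\|_\infty=\sup_{S}\|V(S)\|_1$, and admits a unique fixed point, which coincides with the diffusion value function $$V_D(S)=\mathbb E_\pi\Big[\sum_{t=0}^\infty\Gamma^{t+1}R^t\;\Big|\;S^0=S\Big].$$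
   Context: Graph-based Markov decision process (GMDP). Agents are indexed by $\mathcal V=\{1,\dots,n\}$. Agent $i$ has local state space $\mathcal S_i$ and action space $\mathcal A_i$; an additional space $\mathcal S_0$ collects any global or unobserved state variables. The joint spaces are $\mathcal S=\prod_{i\in\mathcal V\cup\{0\}}\mathcal S_i$ and $\mathcal A=\prod_{i\in\mathcal V}\mathcal A_i$. The influence graph $(\mathcal V,\mathcal E)$ is a directed graph with $(i,i)\in\mathcal E$ for all $i$. For a node $i$ let $N_i^{\mathrm{in}}=\{j:(j,i)\in\mathcal E\}$, and for $N\subseteq\mathcal V$ write $X_N=(X_j)_{j\in N}$. Rewards and transitions factorise as $$\mathcal R(S,A)=n^{-1}\sum_{i\in\mathcal V}\mathcal R_i(S_{N_i^{\mathrm{in}}},S_0;A_{N_i^{\mathrm{in}}}),\qquad T(S'|S,A)=T_0(S_0'|S_0)\prod_{i\in\mathcal V}T_i(S_i'|S_{N_i^{\mathrm{in}}},S_0;A_{N_i^{\mathrm{in}}}).$$ At time $t$ the state is $S^t$, the joint action is $A^t$, and $S^{t+1}\sim T(\cdot|S^t,A^t)$. The local reward at node $i$ is $R_i^t=\mathcal R_i(S^t_{N_i^{\mathrm{in}}},S_0^t;A^t_{N_i^{\mathrm{in}}})\in\mathbb R$, and $R^t=(R_1^t,\dots,R_n^t)^\top$. A joint policy is $\pi=(\pi_1,\dots,\pi_n)$, where $\pi_i$ is the policy of agent $i$, mapping its local observations $\tau_i^t=(S_i^{0:t},A_i^{0:t-1})$ (its own states up to time $t$ and its own actions up to time $t-1$)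 to a distribution over actions in $\mathcal A_i$. $\mathbb E_\pi$ denotes expectation under the process generated by $\pi$ and $T$. $\mathbb A\in\{0,1\}^{n\times n}$ is the adjacency matrix of the influence graph ($\mathbb A_{ij}=1$ iff $(i,j)\in\mathcal E$), and $D$ is the diagonal in-degree matrix, $D_{ii}=\sum_j\mathbb A_{ji}$ (positive because every node has a self-loop). For a vector $x\in\mathbb R^n$, $\|x\|_1=\sum_i|x_i|$; for a matrix, $\|\cdot\|_1$ is the induced norm (maximum absolute column sum).
   Formalization: Rewards are assumed bounded (else T^π need not preserve bounded functions); T^π is defined at t=0, and its fixed point is identified with V_D only if the defining equation holds at every t, as it can fail for history-dependent policies. Bounded functions are taken measurable. *)

theory Defs
  imports "HOL-Probability.Probability"
begin

definition norm1 :: "real ^ 'n \<Rightarrow> real" where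
  "norm1 x = (\<Sum>i\<in>UNIV. \<bar>x $ i\<bar>)"

definition mat_norm1 :: "real ^ 'n ^ 'n \<Rightarrow> real" where
  "mat_norm1 A = (SUP x\<in>{x. norm1 x = 1}. norm1 (A *v x))"

text \<open>The library's power on \<open>real ^ 'n ^ 'n\<close> is taken entry by entry, so the matrix power is
  defined here.\<close>

primrec mat_pow :: "real ^ 'n ^ 'n \<Rightarrow> nat \<Rightarrow> real ^ 'n ^ 'n" where
  "mat_pow A 0 = mat 1"
| "mat_pow A (Suc k) = A ** mat_pow A k"

text \<open>
  The agents are the elements of the finite type \<open>'n\<close>. Every state and action space is a measurable
  space given by a measure of which only the carrier and the sigma-algebra matter; a finite or
  countable space is \<open>count_space X\<close>. The reward and the transition kernel of agent \<open>i\<close> take the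
  triple of the neighbourhood states, the global state and the neighbourhood actions.
\<close>

record ('n, 'g, 's, 'a) gmdp =
  edges :: "('n \<times> 'n) set"
  global_space :: "'g measure"
  local_space :: "'n \<Rightarrow> 's measure"
  action_space :: "'n \<Rightarrow> 'a measure"
  reward :: "'n \<Rightarrow> ('n \<Rightarrow> 's) \<times> 'g \<times> ('n \<Rightarrow> 'a) \<Rightarrow> real"
  global_trans :: "'g \<Rightarrow> 'g measure"
  local_trans :: "'n \<Rightarrow> ('n \<Rightarrow> 's) \<times> 'g \<times> ('n \<Rightarrow> 'a) \<Rightarrow> 's measure"

type_synonym ('n, 'g, 's) state = "'g \<times> ('n \<Rightarrow> 's)"

definition in_nbhd :: "('n, 'g, 's, 'a) gmdp \<Rightarrow> 'n \<Rightarrow> 'n set" where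
  "in_nbhd G i = {j. (j, i) \<in> edges G}"

definition states :: "('n, 'g, 's, 'a) gmdp \<Rightarrow> ('n, 'g, 's) state measure" where
  "states G = global_space G \<Otimes>\<^sub>M PiM UNIV (local_space G)"

definition actions :: "('n, 'g, 's, 'a) gmdp \<Rightarrow> ('n \<Rightarrow> 'a) measure" where
  "actions G = PiM UNIV (action_space G)"

definition nbhd_space :: "('n, 'g, 's, 'a) gmdp \<Rightarrow> 'n \<Rightarrow> (('n \<Rightarrow> 's) \<times> 'g \<times> ('n \<Rightarrow> 'a)) measure" where
  "nbhd_space G i =
     PiM (in_nbhd G i) (local_space G) \<Otimes>\<^sub>M global_space G \<Otimes>\<^sub>M PiM (in_nbhd G i) (action_space G)"

definition nbhd_view ::
  "('n, 'g, 's, 'a) gmdp \<Rightarrow> 'n \<Rightarrow> ('n, 'g, 's) state \<Rightarrow> ('n \<Rightarrow> 'a) \<Rightarrow> ('n \<Rightarrow> 's) \<times> 'g \<times> ('n \<Rightarrow> 'a)" where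
  "nbhd_view G i S A = (restrict (snd S) (in_nbhd G i), fst S, restrict A (in_nbhd G i))"

definition is_gmdp :: "('n::finite, 'g, 's, 'a) gmdp \<Rightarrow> bool" where
  "is_gmdp G \<longleftrightarrow>
     (\<forall>i. (i, i) \<in> edges G) \<and>
     space (global_space G) \<noteq> {} \<and>
     (\<forall>i. space (local_space G i) \<noteq> {}) \<and>
     (\<forall>i. reward G i \<in> borel_measurable (nbhd_space G i)) \<and>
     global_trans G \<in> global_space G \<rightarrow>\<^sub>M prob_algebra (global_space G) \<and>
     (\<forall>i. local_trans G i \<in> nbhd_space G i \<rightarrow>\<^sub>M prob_algebra (local_space G i))"

definition reward_vec ::
  "('n::finite, 'g, 's, 'a) gmdp \<Rightarrow> ('n, 'g, 's) state \<Rightarrow> ('n \<Rightarrow> 'a) \<Rightarrow> real ^ 'n" where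
  "reward_vec G S A = (\<chi> i. reward G i (nbhd_view G i S A))"

definition joint_trans ::
  "('n, 'g, 's, 'a) gmdp \<Rightarrow> ('n, 'g, 's) state \<Rightarrow> ('n \<Rightarrow> 'a) \<Rightarrow> ('n, 'g, 's) state measure" where
  "joint_trans G S A =
     global_trans G (fst S) \<Otimes>\<^sub>M PiM UNIV (\<lambda>i. local_trans G i (nbhd_view G i S A))"

text \<open>
  \<open>\<pi> i t\<close> maps the observation of agent \<open>i\<close> at time \<open>t\<close>, i.e. its own states at times \<open>0..t\<close> and its
  own actions at times \<open>0..<t\<close>, to a distribution over its actions.
\<close>

type_synonym ('n, 's, 'a) policy = "'n \<Rightarrow> nat \<Rightarrow> (nat \<Rightarrow> 's) \<times> (nat \<Rightarrow> 'a) \<Rightarrow> 'a measure"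

definition is_policy :: "('n, 'g, 's, 'a) gmdp \<Rightarrow> ('n, 's, 'a) policy \<Rightarrow> bool" where
  "is_policy G \<pi> \<longleftrightarrow> (\<forall>i t. \<pi> i t \<in>
     PiM {0..t} (\<lambda>_. local_space G i) \<Otimes>\<^sub>M PiM {0..<t} (\<lambda>_. action_space G i)
       \<rightarrow>\<^sub>M prob_algebra (action_space G i))"

text \<open>
  A trajectory \<open>\<omega>\<close> has \<open>\<omega> t = (S\<^sup>t, A\<^sup>t)\<close>. \<open>joint_policy \<pi> t \<omega> S\<close> is the law of \<open>A\<^sup>t\<close> given the
  trajectory \<open>\<omega>\<close> before time \<open>t\<close> and \<open>S\<^sup>t = S\<close>; \<open>step_kernel G \<pi> s t \<omega>\<close> is the law of
  \<open>(S\<^sup>t, A\<^sup>t)\<close> given the trajectory before time \<open>t\<close>, for the process started in \<open>S\<^sup>0 = s\<close>.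
\<close>

definition joint_policy ::
  "('n, 's, 'a) policy \<Rightarrow> nat \<Rightarrow> (nat \<Rightarrow> ('n, 'g, 's) state \<times> ('n \<Rightarrow> 'a)) \<Rightarrow> ('n, 'g, 's) state
     \<Rightarrow> ('n \<Rightarrow> 'a) measure" where
  "joint_policy \<pi> t \<omega> S = PiM UNIV (\<lambda>i. \<pi> i t
     (\<lambda>k\<in>{0..t}. snd (if k = t then S else fst (\<omega> k)) i, \<lambda>k\<in>{0..<t}. snd (\<omega> k) i))"

definition step_kernel ::
  "('n, 'g, 's, 'a) gmdp \<Rightarrow> ('n, 's, 'a) policy \<Rightarrow> ('n, 'g, 's) state \<Rightarrow> nat
     \<Rightarrow> (nat \<Rightarrow> ('n, 'g, 's) state \<times> ('n \<Rightarrow> 'a)) \<Rightarrow> (('n, 'g, 's) state \<times> ('n \<Rightarrow> 'a)) measure" where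
  "step_kernel G \<pi> s t \<omega> =
     (case t of 0 \<Rightarrow> return (states G) s | Suc u \<Rightarrow> joint_trans G (fst (\<omega> u)) (snd (\<omega> u)))
       \<bind> (\<lambda>S. distr (joint_policy \<pi> t \<omega> S) (states G \<Otimes>\<^sub>M actions G) (Pair S))"

text \<open>The law of the trajectory started in \<open>S\<^sup>0 = s\<close>, by the Ionescu-Tulcea extension theorem.\<close>

definition trajectory ::
  "('n, 'g, 's, 'a) gmdp \<Rightarrow> ('n, 's, 'a) policy \<Rightarrow> ('n, 'g, 's) state
     \<Rightarrow> (nat \<Rightarrow> ('n, 'g, 's) state \<times> ('n \<Rightarrow> 'a)) measure" where
  "trajectory G \<pi> s =
     projective_family.lim UNIV
       (Ionescu_Tulcea.CI (step_kernel G \<pi> s) (\<lambda>_. states G \<Otimes>\<^sub>M actions G))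
       (\<lambda>_. states G \<Otimes>\<^sub>M actions G)"

definition state_at :: "nat \<Rightarrow> (nat \<Rightarrow> ('n, 'g, 's) state \<times> ('n \<Rightarrow> 'a)) \<Rightarrow> ('n, 'g, 's) state" where
  "state_at t \<omega> = fst (\<omega> t)"

definition reward_at ::
  "('n::finite, 'g, 's, 'a) gmdp \<Rightarrow> nat \<Rightarrow> (nat \<Rightarrow> ('n, 'g, 's) state \<times> ('n \<Rightarrow> 'a)) \<Rightarrow> real ^ 'n" where
  "reward_at G t \<omega> = reward_vec G (fst (\<omega> t)) (snd (\<omega> t))"

definition adjacency :: "('n::finite, 'g, 's, 'a) gmdp \<Rightarrow> real ^ 'n ^ 'n" where
  "adjacency G = (\<chi> i j. if (i, j) \<in> edges G then 1 else 0)"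

definition in_degree :: "('n::finite, 'g, 's, 'a) gmdp \<Rightarrow> real ^ 'n ^ 'n" where
  "in_degree G = (\<chi> i j. if i = j then (\<Sum>k\<in>UNIV. adjacency G $ k $ i) else 0)"

definition diffusion :: "('n::finite, 'g, 's, 'a) gmdp \<Rightarrow> real \<Rightarrow> real ^ 'n ^ 'n" where
  "diffusion G \<gamma> = \<gamma> *\<^sub>R (adjacency G ** matrix_inv (in_degree G))"

text \<open>
  Functions on the state space are represented extensionally, so that equality of functions is
  equality on \<open>space (states G)\<close>. Measurability is no restriction on countable discrete spaces.
\<close>

definition bounded_funs :: "('n::finite, 'g, 's, 'a) gmdp \<Rightarrow> (('n, 'g, 's) state \<Rightarrow> real ^ 'n) set" where
  "bounded_funs G = {V. V \<in> borel_measurable (states G) \<and> V \<in> extensional (space (states G)) \<and>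
     (\<exists>B. \<forall>S\<in>space (states G). norm1 (V S) \<le> B)}"

definition sup_norm :: "('n::finite, 'g, 's, 'a) gmdp \<Rightarrow> (('n, 'g, 's) state \<Rightarrow> real ^ 'n) \<Rightarrow> real" where
  "sup_norm G V = (SUP S\<in>space (states G). norm1 (V S))"

text \<open>The operator is given by the instance \<open>t = 0\<close> of its defining equation.\<close>

definition bellman ::
  "('n::finite, 'g, 's, 'a) gmdp \<Rightarrow> ('n, 's, 'a) policy \<Rightarrow> real
     \<Rightarrow> (('n, 'g, 's) state \<Rightarrow> real ^ 'n) \<Rightarrow> ('n, 'g, 's) state \<Rightarrow> real ^ 'n" where
  "bellman G \<pi> \<gamma> V = (\<lambda>S\<in>space (states G).
     diffusion G \<gamma> *v (\<integral>\<omega>. reward_at G 0 \<omega> + V (state_at 1 \<omega>) \<partial>trajectory G \<pi> S))"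

text \<open>
  The defining equation \<open>(\<T> V)(S) = \<Gamma> E[R\<^sup>t + V(S\<^sup>t\<^sup>+\<^sup>1) | S\<^sup>t = S]\<close> leaves the time \<open>t\<close> open, so it defines
  a single operator only if its right-hand side does not depend on \<open>t\<close>. It does not if the policy uses
  the current local states only, but it may if the policy uses the history: with one agent, one
  state, reward equal to the action, action 0 at time 0 and action 1 afterwards, the equation at
  \<open>t = 0\<close> has the fixed point 0, while the diffusion value is positive.
  \<open>bellman_at_all_times\<close> states the equation for every \<open>t\<close>, as an almost sure identity with the
  conditional expectation given \<open>S\<^sup>t\<close>, whatever the initial state \<open>s\<close>.
\<close>

definition state_algebra ::
  "('n, 'g, 's, 'a) gmdp \<Rightarrow> ('n, 's, 'a) policy \<Rightarrow> ('n, 'g, 's) state \<Rightarrow> nat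
     \<Rightarrow> (nat \<Rightarrow> ('n, 'g, 's) state \<times> ('n \<Rightarrow> 'a)) measure" where
  "state_algebra G \<pi> s t = vimage_algebra (space (trajectory G \<pi> s)) (state_at t) (states G)"

definition bellman_at_all_times ::
  "('n::finite, 'g, 's, 'a) gmdp \<Rightarrow> ('n, 's, 'a) policy \<Rightarrow> real \<Rightarrow> bool" where
  "bellman_at_all_times G \<pi> \<gamma> \<longleftrightarrow>
     (\<forall>s\<in>space (states G). \<forall>t. \<forall>V\<in>bounded_funs G. AE \<omega> in trajectory G \<pi> s.
        bellman G \<pi> \<gamma> V (state_at t \<omega>) =
        diffusion G \<gamma> *v (\<chi> i. real_cond_exp (trajectory G \<pi> s) (state_algebra G \<pi> s t)
          (\<lambda>\<omega>. (reward_at G t \<omega> + V (state_at (Suc t) \<omega>)) $ i) \<omega>))"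

definition diffusion_value ::
  "('n::finite, 'g, 's, 'a) gmdp \<Rightarrow> ('n, 's, 'a) policy \<Rightarrow> real \<Rightarrow> ('n, 'g, 's) state \<Rightarrow> real ^ 'n" where
  "diffusion_value G \<pi> \<gamma> = (\<lambda>S\<in>space (states G).
     \<integral>\<omega>. (\<Sum>t. mat_pow (diffusion G \<gamma>) (t + 1) *v reward_at G t \<omega>) \<partial>trajectory G \<pi> S)"

end

theory Submission
  imports Defs
begin

text \<open>
  All columns of \<open>\<Gamma>\<close> are nonnegative and sum to \<open>\<gamma>\<close>, so \<open>\<Gamma>\<close> shrinks the 1-norm by the factor \<open>\<gamma>\<close>, and
  the Bellman operator, which applies \<open>\<Gamma>\<close> to an expectation, is a contraction; its iterates converge
  uniformly to the fixed point \<open>V\<close>. If the Bellman equation holds at every time, taking expectations in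
  it gives \<open>E V(S\<^sup>t) = \<Gamma> (E R\<^sup>t + E V(S\<^sup>t\<^sup>+\<^sup>1))\<close> for the process started in \<open>s\<close>. Unrolled from
  \<open>t = 0\<close>, where \<open>E V(S\<^sup>0) = V(s)\<close>, this is \<open>V(s) = E \<Sum>t<n. \<Gamma>\<^sup>t\<^sup>+\<^sup>1 R\<^sup>t + \<Gamma>\<^sup>n E V(S\<^sup>n)\<close>, whose limit
  identifies \<open>V\<close> with the diffusion value function. In particular the measurability and the
  boundedness of the latter come from \<open>V\<close>.
\<close>

subsection \<open>The 1-norm and the diffusion matrix\<close>

lemma norm1_nonneg: "0 \<le> norm1 x"
  by (simp add: norm1_def sum_nonneg)

lemma norm1_zero [simp]: "norm1 0 = 0"
  by (simp add: norm1_def)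

lemma norm1_eq_0_iff: "norm1 x = 0 \<longleftrightarrow> x = 0"
  by (auto simp: norm1_def sum_nonneg_eq_0_iff vec_eq_iff)

lemma norm1_triangle: "norm1 (x + y) \<le> norm1 x + norm1 y"
  by (auto simp: norm1_def sum.distrib[symmetric] intro!: sum_mono)

lemma norm1_minus_commute: "norm1 (x - y) = norm1 (y - x)"
  by (simp add: norm1_def abs_minus_commute)

lemma norm1_diff_triangle: "norm1 (x - z) \<le> norm1 (x - y) + norm1 (y - z)"
  using norm1_triangle[of "x - y" "y - z"] by simp

lemma norm_le_norm1: "norm x \<le> norm1 x"
  by (simp add: norm1_def norm_le_l1_cart)

lemma tendsto_norm1 [tendsto_intros]:
  "(f \<longlongrightarrow> l) F \<Longrightarrow> ((\<lambda>x. norm1 (f x)) \<longlongrightarrow> norm1 l) F"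
  unfolding norm1_def by (intro tendsto_intros)

lemma norm1_axis: "norm1 (axis j 1) = 1"
  by (simp add: norm1_def axis_def if_distrib[of abs] cong: if_cong)

text \<open>Swapping the two sums groups the terms by column, so each
  \<open>\<bar>x $ j\<bar>\<close> is weighted by one absolute column sum.\<close>

lemma norm1_mult_le:
  fixes A :: "real ^ 'n ^ 'n"
  assumes "\<And>j. (\<Sum>i\<in>UNIV. \<bar>A $ i $ j\<bar>) \<le> c"
  shows "norm1 (A *v x) \<le> c * norm1 x"
proof -
  have "norm1 (A *v x) \<le> (\<Sum>i\<in>UNIV. \<Sum>j\<in>UNIV. \<bar>A $ i $ j\<bar> * \<bar>x $ j\<bar>)"
    unfolding norm1_def matrix_vector_mult_def
    by (intro sum_mono) (auto simp: abs_mult[symmetric])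
  also have "\<dots> = (\<Sum>j\<in>UNIV. (\<Sum>i\<in>UNIV. \<bar>A $ i $ j\<bar>) * \<bar>x $ j\<bar>)"
    by (subst sum.swap) (simp add: sum_distrib_right)
  also have "\<dots> \<le> (\<Sum>j\<in>UNIV. c * \<bar>x $ j\<bar>)"
    by (intro sum_mono mult_right_mono assms) auto
  finally show ?thesis
    by (simp add: norm1_def sum_distrib_left)
qed

text \<open>Column sums bound the norm on the unit sphere, and the unit vector of a largest column
  attains the bound, so the supremum is a maximum.\<close>

lemma mat_norm1_eq_Max:
  "mat_norm1 A = Max (range (\<lambda>j. \<Sum>i\<in>UNIV. \<bar>A $ i $ j\<bar>))" (is "_ = ?m")
proof -
  have le: "(\<Sum>i\<in>UNIV. \<bar>A $ i $ j\<bar>) \<le> ?m" for j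
    by (intro Max_ge) auto
  have bound: "norm1 (A *v x) \<le> ?m" if "norm1 x = 1" for x
    using norm1_mult_le[OF le, of x] that by simp
  have "?m \<in> range (\<lambda>j. \<Sum>i\<in>UNIV. \<bar>A $ i $ j\<bar>)"
    by (intro Max_in) auto
  then obtain j where j: "?m = (\<Sum>i\<in>UNIV. \<bar>A $ i $ j\<bar>)"
    by blast
  have col: "norm1 (A *v axis j 1) = ?m"
    unfolding j by (simp add: norm1_def matrix_vector_mult_basis column_def)
  show ?thesis
    unfolding mat_norm1_def
  proof (rule cSup_eq_maximum)
    show "?m \<in> (\<lambda>x. norm1 (A *v x)) ` {x. norm1 x = 1}"
      using col norm1_axis[of j] by (intro image_eqI[of _ _ "axis j 1"]) auto
  qed (use bound in auto)
qed

text \<open>\<open>mat_pow\<close> grows on the left, whereas unrolling the value recursion puts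
  each new factor on the right.\<close>

lemma mat_pow_commute: "A ** mat_pow A k = mat_pow A k ** A"
proof (induction k)
  case (Suc k)
  have "A ** (A ** mat_pow A k) = A ** (mat_pow A k ** A)"
    by (simp only: Suc)
  then show ?case
    by (simp only: mat_pow.simps matrix_mul_assoc)
qed simp

text \<open>\<open>matrix_inv\<close> is a choice among two-sided inverses. The witness
  \<open>B\<close> shows that one exists, and associativity of \<open>B ** A ** matrix_inv A\<close>
  forces the choice to be \<open>B\<close>.\<close>

lemma matrix_inv_unique:
  fixes A B :: "'a::semiring_1 ^ 'n ^ 'n"
  assumes "A ** B = mat 1" "B ** A = mat 1"
  shows "matrix_inv A = B"
proof -
  have "A ** matrix_inv A = mat 1 \<and> matrix_inv A ** A = mat 1"
    unfolding matrix_inv_def by (rule someI[of _ B]) (use assms in auto)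
  then show ?thesis
    using matrix_mul_assoc[of B A "matrix_inv A"] assms(2) by simp
qed

lemma matrix_inv_diagonal:
  fixes d :: "'n::finite \<Rightarrow> 'a::field"
  assumes "\<And>i. d i \<noteq> 0"
  shows "matrix_inv (\<chi> i j. if i = j then d i else 0) = (\<chi> i j. if i = j then inverse (d i) else 0)"
proof (rule matrix_inv_unique)
  \<comment> \<open>Diagonal matrices multiply entrywise on the diagonal; stated for general
    \<open>f\<close> and \<open>g\<close>, this covers both orders of the product.\<close>
  have diag: "(\<chi> i j. if i = j then f i else 0) ** (\<chi> i j. if i = j then g i else 0) = mat 1"
    if "\<And>i. f i * g i = 1" for f g :: "'n \<Rightarrow> 'a"
    using that
    by (auto simp: matrix_matrix_mult_def mat_def vec_eq_iff if_distrib[of "\<lambda>x. x * _"] cong: if_cong)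
  show "(\<chi> i j. if i = j then d i else 0) ** (\<chi> i j. if i = j then inverse (d i) else 0) = mat 1"
    and "(\<chi> i j. if i = j then inverse (d i) else 0) ** (\<chi> i j. if i = j then d i else 0) = mat 1"
    using assms by (auto intro!: diag)
qed

text \<open>The self-loop contributes a 1 to column \<open>j\<close>, so every in-degree is positive
  and the degree matrix is invertible; multiplying by its inverse on the right divides each column
  by its in-degree.\<close>

lemma diffusion_nth:
  assumes "\<And>i. (i, i) \<in> edges G"
  shows "diffusion G \<gamma> $ i $ j = \<gamma> * adjacency G $ i $ j / (\<Sum>k\<in>UNIV. adjacency G $ k $ j)"
    and "0 < (\<Sum>k\<in>UNIV. adjacency G $ k $ j)"
proof -
  show pos: "0 < (\<Sum>k\<in>UNIV. adjacency G $ k $ j)" for j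
    using assms[of j] by (intro sum_pos2[of _ j]) (auto simp: adjacency_def)
  have "matrix_inv (in_degree G) = (\<chi> i j. if i = j then inverse (\<Sum>k\<in>UNIV. adjacency G $ k $ i) else 0)"
    unfolding in_degree_def using pos by (intro matrix_inv_diagonal) (metis less_irrefl)
  then show "diffusion G \<gamma> $ i $ j = \<gamma> * adjacency G $ i $ j / (\<Sum>k\<in>UNIV. adjacency G $ k $ j)"
    by (simp add: diffusion_def matrix_matrix_mult_def if_distrib[of "\<lambda>x. _ * x"] divide_inverse
        cong: if_cong)
qed

lemma diffusion_nonneg:
  assumes "\<And>i. (i, i) \<in> edges G" "0 \<le> \<gamma>"
  shows "0 \<le> diffusion G \<gamma> $ i $ j"
proof -
  have "0 \<le> adjacency G $ i $ j"
    by (simp add: adjacency_def)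
  then show ?thesis
    using diffusion_nth[where G=G and j=j, OF assms(1)] assms(2) by (simp add: less_imp_le)
qed

text \<open>Each column of the adjacency matrix is divided by its own sum, which leaves only the
  factor \<gamma>.\<close>

lemma diffusion_column_sum:
  assumes "\<And>i. (i, i) \<in> edges G"
  shows "(\<Sum>i\<in>UNIV. diffusion G \<gamma> $ i $ j) = \<gamma>"
proof -
  have "(\<Sum>i\<in>UNIV. diffusion G \<gamma> $ i $ j) =
      (\<gamma> * (\<Sum>k\<in>UNIV. adjacency G $ k $ j)) / (\<Sum>k\<in>UNIV. adjacency G $ k $ j)"
    using assms by (simp add: diffusion_nth(1) sum_divide_distrib sum_distrib_left)
  also have "\<dots> = \<gamma>"
    using diffusion_nth(2)[of G j, OF assms] by simp
  finally show ?thesis .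
qed

lemma norm1_diffusion_le:
  assumes "\<And>i. (i, i) \<in> edges G" "0 \<le> \<gamma>"
  shows "norm1 (diffusion G \<gamma> *v x) \<le> \<gamma> * norm1 x"
  by (rule norm1_mult_le) (simp add: diffusion_nonneg diffusion_column_sum assms)

lemma norm1_mat_pow_diffusion_le:
  assumes "\<And>i. (i, i) \<in> edges G" "0 \<le> \<gamma>"
  shows "norm1 (mat_pow (diffusion G \<gamma>) k *v x) \<le> \<gamma> ^ k * norm1 x"
proof (induction k)
  case (Suc k)
  have "norm1 (mat_pow (diffusion G \<gamma>) (Suc k) *v x) \<le> \<gamma> * norm1 (mat_pow (diffusion G \<gamma>) k *v x)"
    using norm1_diffusion_le[OF assms] by (simp add: matrix_vector_mul_assoc[symmetric])
  also have "\<dots> \<le> \<gamma> * (\<gamma> ^ k * norm1 x)"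
    by (intro mult_left_mono Suc assms)
  finally show ?case by simp
qed simp

section \<open>Vector-valued expectations and the 1-norm\<close>

lemma borel_measurable_vec_lambda:
  fixes f :: "'n::finite \<Rightarrow> 'a \<Rightarrow> real"
  assumes "\<And>i. f i \<in> borel_measurable M"
  shows "(\<lambda>x. \<chi> i. f i x) \<in> borel_measurable M"
  by (subst borel_measurable_euclidean_space)
     (auto simp: Basis_vec_def inner_axis assms)

lemma integral_vec_nth:
  fixes f :: "'a \<Rightarrow> real ^ 'n"
  assumes "integrable M f"
  shows "(\<integral>x. f x \<partial>M) $ i = (\<integral>x. f x $ i \<partial>M)"
  using integral_bounded_linear[OF bounded_linear_vec_nth assms] by simp

lemma integrable_vec_nth:
  fixes f :: "'a \<Rightarrow> real ^ 'n"
  assumes "integrable M f"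
  shows "integrable M (\<lambda>x. f x $ i)"
  by (rule integrable_bounded_linear[OF bounded_linear_vec_nth assms])

lemma integrable_vec_lambda:
  fixes f :: "'n::finite \<Rightarrow> 'a \<Rightarrow> real"
  assumes "\<And>i. integrable M (f i)"
  shows "integrable M (\<lambda>x. \<chi> i. f i x)"
proof -
  \<comment> \<open>Expanding along the unit vectors reduces the claim to a finite sum of integrable
    scalar functions.\<close>
  have "(\<lambda>x. \<chi> i. f i x) = (\<lambda>x. \<Sum>i\<in>UNIV. f i x *\<^sub>R axis i 1)"
    by (auto simp: vec_eq_iff axis_def if_distrib[of "\<lambda>x. _ * x"] cong: if_cong)
  then show ?thesis
    using assms by (simp add: integrable_sum)
qed

text \<open>The 1-norm is a finite sum of absolute values, so the triangle inequality for scalar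
  integrals applies in each coordinate.\<close>

lemma norm1_integral_le:
  fixes f :: "'a \<Rightarrow> real ^ 'n"
  assumes "integrable M f"
  shows "norm1 (\<integral>x. f x \<partial>M) \<le> (\<integral>x. norm1 (f x) \<partial>M)"
proof -
  have "norm1 (\<integral>x. f x \<partial>M) \<le> (\<Sum>i\<in>UNIV. \<integral>x. \<bar>f x $ i\<bar> \<partial>M)"
    unfolding norm1_def integral_vec_nth[OF assms] by (intro sum_mono integral_abs_bound)
  also have "\<dots> = (\<integral>x. norm1 (f x) \<partial>M)"
    unfolding norm1_def
    by (subst Bochner_Integration.integral_sum) (auto intro!: integrable_abs integrable_vec_nth assms)
  finally show ?thesis .
qed

lemma (in prob_space) integrable_norm1_bounded:
  fixes f :: "'a \<Rightarrow> real ^ 'n"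
  assumes "f \<in> borel_measurable M" "\<And>x. x \<in> space M \<Longrightarrow> norm1 (f x) \<le> B"
  shows "integrable M f"
  using assms order_trans[OF norm_le_norm1]
  by (intro integrable_const_bound[of _ B]) (auto intro!: AE_I2)

lemma (in prob_space) norm1_expectation_le:
  fixes f :: "'a \<Rightarrow> real ^ 'n"
  assumes "f \<in> borel_measurable M" and B: "\<And>x. x \<in> space M \<Longrightarrow> norm1 (f x) \<le> B"
  shows "norm1 (\<integral>x. f x \<partial>M) \<le> B"
proof -
  have "norm1 (\<integral>x. f x \<partial>M) \<le> (\<integral>x. norm1 (f x) \<partial>M)"
    by (intro norm1_integral_le integrable_norm1_bounded[OF assms])
  \<comment> \<open>Monotonicity asks for \<open>0 \<le> B\<close> at each point of the space; it
    follows because \<open>B\<close> dominates a norm there.\<close>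
  also have "\<dots> \<le> (\<integral>x. B \<partial>M)"
    using B order_trans[OF norm1_nonneg B]
    by (intro integral_mono' integrable_const AE_I2) auto
  finally show ?thesis
    by (simp add: prob_space)
qed

lemma integral_matrix_vector_mult:
  fixes A :: "real ^ 'n ^ 'm" and f :: "'a \<Rightarrow> real ^ 'n"
  assumes "integrable M f"
  shows "(\<integral>x. A *v f x \<partial>M) = A *v (\<integral>x. f x \<partial>M)"
  using integral_bounded_linear[OF matrix_vector_mul_bounded_linear assms] .

subsection \<open>The law of the trajectory\<close>

abbreviation steps :: "('n, 'g, 's, 'a) gmdp \<Rightarrow> (('n, 'g, 's) state \<times> ('n \<Rightarrow> 'a)) measure" where
  "steps G \<equiv> states G \<Otimes>\<^sub>M actions G"

text \<open>Measurability of a kernel can be tested on the rectangles, which generate the product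
  sigma-algebra and are closed under intersection; the measure of a rectangle is a finite product of
  functions measurable in \<open>x\<close>.\<close>

lemma measurable_PiM_prob_algebra:
  fixes K :: "'i::finite \<Rightarrow> 'a \<Rightarrow> 'b measure"
  assumes K: "\<And>i. K i \<in> N \<rightarrow>\<^sub>M prob_algebra (M i)"
  shows "(\<lambda>x. PiM UNIV (\<lambda>i. K i x)) \<in> N \<rightarrow>\<^sub>M prob_algebra (PiM UNIV M)"
proof (rule measurable_prob_algebra_generated[OF sets_PiM Int_stable_prod_algebra prod_algebra_sets_into_space])
  fix x assume x: "x \<in> space N"
  have P: "prob_space (K i x)" and S: "sets (K i x) = sets (M i)" for i
    using measurable_space[OF K x, of i] by (auto simp: space_prob_algebra)
  show "sets (PiM UNIV (\<lambda>i. K i x)) = sets (PiM UNIV M)"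
    by (intro sets_PiM_cong S refl)
  show "prob_space (PiM UNIV (\<lambda>i. K i x))"
    by (intro prob_space_PiM P)
next
  fix A assume "A \<in> prod_algebra UNIV M"
  then obtain E where A: "A = Pi\<^sub>E UNIV E" and E: "\<And>i. E i \<in> sets (M i)"
    by (auto elim!: prod_algebraE_all)
  have "emeasure (PiM UNIV (\<lambda>i. K i x)) A = (\<Prod>i\<in>UNIV. emeasure (K i x) (E i))" if x: "x \<in> space N" for x
  proof -
    have P: "prob_space (K i x)" and S: "sets (K i x) = sets (M i)" for i
      using measurable_space[OF K x, of i] by (auto simp: space_prob_algebra)
    interpret product_prob_space "\<lambda>i. K i x" UNIV
      by (intro product_prob_spaceI P)
    show ?thesis
      unfolding A by (rule emeasure_PiM) (auto simp: S E)
  qed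
  moreover have "(\<lambda>x. \<Prod>i\<in>UNIV. emeasure (K i x) (E i)) \<in> borel_measurable N"
    by (intro borel_measurable_prod_ennreal measurable_emeasure_kernel[OF measurable_prob_algebraD[OF K]] E)
  ultimately show "(\<lambda>x. emeasure (PiM UNIV (\<lambda>i. K i x)) A) \<in> borel_measurable N"
    by (simp cong: measurable_cong)
qed

section \<open>Measurability of rewards, transitions and policies\<close>

lemma measurable_nbhd_view:
  fixes G :: "('b, 'g, 's, 'a) gmdp"
  shows "(\<lambda>x. nbhd_view G i (fst x) (snd x)) \<in> steps G \<rightarrow>\<^sub>M nbhd_space G i"
proof -
  have [measurable]: "(\<lambda>f. restrict f (in_nbhd G i)) \<in> PiM UNIV X \<rightarrow>\<^sub>M PiM (in_nbhd G i) X"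
    for X :: "'b \<Rightarrow> 'z measure"
    by (rule measurable_restrict_subset) simp
  show ?thesis
    unfolding nbhd_view_def states_def actions_def nbhd_space_def by measurable
qed

lemma measurable_reward_vec:
  assumes "is_gmdp G"
  shows "(\<lambda>x. reward_vec G (fst x) (snd x)) \<in> borel_measurable (steps G)"
  unfolding reward_vec_def using assms unfolding is_gmdp_def
  by (intro borel_measurable_vec_lambda measurable_compose[OF measurable_nbhd_view]) auto

lemma measurable_joint_trans:
  assumes "is_gmdp G"
  shows "(\<lambda>x. joint_trans G (fst x) (snd x)) \<in> steps G \<rightarrow>\<^sub>M prob_algebra (states G)"
proof -
  have "(\<lambda>x. global_trans G (fst (fst x))) \<in> steps G \<rightarrow>\<^sub>M prob_algebra (global_space G)"
    using assms unfolding is_gmdp_def states_def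
    by (intro measurable_compose[of "\<lambda>x. fst (fst x)" _ _ "global_trans G"]) auto
  moreover have "(\<lambda>x. PiM UNIV (\<lambda>i. local_trans G i (nbhd_view G i (fst x) (snd x))))
      \<in> steps G \<rightarrow>\<^sub>M prob_algebra (PiM UNIV (local_space G))"
    using assms unfolding is_gmdp_def
    by (intro measurable_PiM_prob_algebra measurable_compose[OF measurable_nbhd_view]) auto
  ultimately have "(\<lambda>x. joint_trans G (fst x) (snd x)) \<in> steps G
      \<rightarrow>\<^sub>M prob_algebra (global_space G \<Otimes>\<^sub>M PiM UNIV (local_space G))"
    unfolding joint_trans_def by (rule measurable_pair_prob)
  then show ?thesis
    unfolding states_def .
qed

lemma measurable_joint_policy:
  fixes G :: "('n::finite, 'g, 's, 'a) gmdp"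
  assumes "is_policy G \<pi>"
  shows "(\<lambda>x. joint_policy \<pi> t (fst x) (snd x))
    \<in> PiM {0..<t} (\<lambda>_. steps G) \<Otimes>\<^sub>M states G \<rightarrow>\<^sub>M prob_algebra (actions G)"
proof -
  let ?N = "PiM {0..<t} (\<lambda>_. steps G) \<Otimes>\<^sub>M states G"
  have step: "(\<lambda>x. fst x k) \<in> ?N \<rightarrow>\<^sub>M steps G" if "k < t" for k
    using that by (intro measurable_compose[OF measurable_fst] measurable_component_singleton) auto
  have loc: "(\<lambda>S. snd S i) \<in> states G \<rightarrow>\<^sub>M local_space G i" for i
    unfolding states_def by measurable
  have act: "(\<lambda>A. A i) \<in> actions G \<rightarrow>\<^sub>M action_space G i" for i
    unfolding actions_def by measurable
  have s: "(\<lambda>x. \<lambda>k\<in>{0..t}. snd (if k = t then snd x else fst (fst x k)) i)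
      \<in> ?N \<rightarrow>\<^sub>M PiM {0..t} (\<lambda>_. local_space G i)" for i
  proof (rule measurable_restrict)
    \<comment> \<open>Only the coordinate \<open>k = t\<close> reads the current state; the others
      read the history, which has entries strictly before \<open>t\<close>.\<close>
    fix k assume "k \<in> {0..t}"
    then show "(\<lambda>x. snd (if k = t then snd x else fst (fst x k)) i) \<in> ?N \<rightarrow>\<^sub>M local_space G i"
      using measurable_compose[OF measurable_snd loc]
        measurable_compose[OF measurable_compose[OF step measurable_fst] loc]
      by (cases "k = t") auto
  qed
  have a: "(\<lambda>x. \<lambda>k\<in>{0..<t}. snd (fst x k) i) \<in> ?N \<rightarrow>\<^sub>M PiM {0..<t} (\<lambda>_. action_space G i)" for i
    by (intro measurable_restrict measurable_compose[OF measurable_compose[OF step measurable_snd] act]) auto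
  have \<pi>: "\<pi> i t \<in> PiM {0..t} (\<lambda>_. local_space G i) \<Otimes>\<^sub>M PiM {0..<t} (\<lambda>_. action_space G i)
      \<rightarrow>\<^sub>M prob_algebra (action_space G i)" for i
    using assms by (simp add: is_policy_def)
  have "(\<lambda>x. joint_policy \<pi> t (fst x) (snd x)) \<in> ?N \<rightarrow>\<^sub>M prob_algebra (PiM UNIV (action_space G))"
    unfolding joint_policy_def
    by (intro measurable_PiM_prob_algebra measurable_compose[OF measurable_Pair[OF s a] \<pi>])
  then show ?thesis
    by (simp only: actions_def[symmetric])
qed

text \<open>The start state, which enters the kernel at time 0, is kept as an argument beside the
  history because the trajectory law must later depend measurably on it.\<close>

lemma measurable_step_kernel:
  fixes G :: "('n::finite, 'g, 's, 'a) gmdp"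
  assumes G: "is_gmdp G" and \<pi>: "is_policy G \<pi>"
  shows "(\<lambda>x. step_kernel G \<pi> (fst x) t (snd x))
    \<in> states G \<Otimes>\<^sub>M PiM {0..<t} (\<lambda>_. steps G) \<rightarrow>\<^sub>M prob_algebra (steps G)"
proof -
  let ?N = "states G \<Otimes>\<^sub>M PiM {0..<t} (\<lambda>_. steps G)"
  have "(\<lambda>x. case t of 0 \<Rightarrow> return (states G) (fst x)
      | Suc u \<Rightarrow> joint_trans G (fst (snd x u)) (snd (snd x u))) \<in> ?N \<rightarrow>\<^sub>M prob_algebra (states G)"
  proof (cases t)
    case (Suc u)
    have "(\<lambda>x. snd x u) \<in> ?N \<rightarrow>\<^sub>M steps G"
      using Suc by (intro measurable_compose[OF measurable_snd] measurable_component_singleton) auto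
    from measurable_compose[OF this measurable_joint_trans[OF G]] show ?thesis
      by (simp add: Suc)
  qed simp
  moreover have "(\<lambda>z. distr (joint_policy \<pi> t (snd (fst z)) (snd z)) (steps G) (Pair (snd z)))
      \<in> ?N \<Otimes>\<^sub>M states G \<rightarrow>\<^sub>M prob_algebra (steps G)"
  proof (rule measurable_distr_prob_space2)
    have "(\<lambda>z. (snd (fst z), snd z)) \<in> ?N \<Otimes>\<^sub>M states G \<rightarrow>\<^sub>M PiM {0..<t} (\<lambda>_. steps G) \<Otimes>\<^sub>M states G"
      by measurable
    from measurable_compose[OF this measurable_joint_policy[OF \<pi>]]
    show "(\<lambda>z. joint_policy \<pi> t (snd (fst z)) (snd z)) \<in> ?N \<Otimes>\<^sub>M states G \<rightarrow>\<^sub>M prob_algebra (actions G)"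
      by simp
  qed measurable
  ultimately show ?thesis
    unfolding step_kernel_def by (intro measurable_bind_prob_space2) (simp_all add: case_prod_beta')
qed

section \<open>The trajectory law as a kernel in the start state\<close>

lemma Ionescu_Tulcea_step_kernel:
  fixes G :: "('n::finite, 'g, 's, 'a) gmdp"
  assumes "is_gmdp G" "is_policy G \<pi>" and s: "s \<in> space (states G)"
  shows "Ionescu_Tulcea (step_kernel G \<pi> s) (\<lambda>_. steps G)"
proof (rule Ionescu_Tulcea.intro)
  fix t :: nat
  have "(\<lambda>\<omega>. (s, \<omega>)) \<in> PiM {0..<t} (\<lambda>_. steps G) \<rightarrow>\<^sub>M states G \<Otimes>\<^sub>M PiM {0..<t} (\<lambda>_. steps G)"
    using s by measurable
  from measurable_compose[OF this measurable_step_kernel[OF assms(1,2), of t]]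
  have K: "step_kernel G \<pi> s t \<in> PiM {0..<t} (\<lambda>_. steps G) \<rightarrow>\<^sub>M prob_algebra (steps G)"
    by simp
  then show "step_kernel G \<pi> s t \<in> PiM {0..<t} (\<lambda>_. steps G) \<rightarrow>\<^sub>M subprob_algebra (steps G)"
    by (rule measurable_prob_algebraD)
  show "prob_space (step_kernel G \<pi> s t \<omega>)" if "\<omega> \<in> space (PiM {0..<t} (\<lambda>_. steps G))" for \<omega>
    using measurable_space[OF K that] by (simp add: space_prob_algebra)
qed

text \<open>\<open>?C n s\<close> is the law of the first \<open>n\<close> steps. Each extension
  binds a prefix law measurable in \<open>s\<close> with a kernel jointly measurable in
  \<open>s\<close> and the prefix, so induction on \<open>n\<close> applies.\<close>

lemma measurable_Ionescu_Tulcea_C: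
  fixes G :: "('n::finite, 'g, 's, 'a) gmdp"
  assumes "is_gmdp G" "is_policy G \<pi>"
  shows "(\<lambda>s. Ionescu_Tulcea.C (step_kernel G \<pi> s) (\<lambda>_. steps G) 0 n (\<lambda>_. undefined))
    \<in> states G \<rightarrow>\<^sub>M prob_algebra (PiM {0..<n} (\<lambda>_. steps G))" (is "?C n \<in> _")
proof (induction n)
  case 0
  \<comment> \<open>The empty product has the single point \<open>\<lambda>_. undefined\<close>, so
    the law of the empty prefix is constant in \<open>s\<close>.\<close>
  have "?C 0 s = return (PiM {} (\<lambda>_. steps G)) (\<lambda>_. undefined)" if "s \<in> space (states G)" for s
    using Ionescu_Tulcea.C.simps(1)[OF Ionescu_Tulcea_step_kernel[OF assms that]] by simp
  moreover have "return (PiM {} (\<lambda>_. steps G)) (\<lambda>_. undefined) \<in> space (prob_algebra (PiM {} (\<lambda>_. steps G)))"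
    by (intro measurable_space[OF measurable_return_prob_space]) (simp add: space_PiM)
  ultimately show ?case
    by (subst measurable_cong[where g = "\<lambda>_. return (PiM {} (\<lambda>_. steps G)) (\<lambda>_. undefined)"]) auto
next
  case (Suc n)
  have "?C (Suc n) s = ?C n s \<bind> (\<lambda>\<omega>. distr (step_kernel G \<pi> s n \<omega>) (PiM {0..<Suc n} (\<lambda>_. steps G)) (fun_upd \<omega> n))"
    if "s \<in> space (states G)" for s
  proof -
    interpret Ionescu_Tulcea "step_kernel G \<pi> s" "\<lambda>_. steps G"
      by (rule Ionescu_Tulcea_step_kernel[OF assms that])
    show ?thesis
      by (simp add: eP_def[abs_def])
  qed
  moreover have "(\<lambda>s. ?C n s \<bind> (\<lambda>\<omega>. distr (step_kernel G \<pi> s n \<omega>) (PiM {0..<Suc n} (\<lambda>_. steps G)) (fun_upd \<omega> n)))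
      \<in> states G \<rightarrow>\<^sub>M prob_algebra (PiM {0..<Suc n} (\<lambda>_. steps G))"
  proof (rule measurable_bind_prob_space2[OF Suc])
    have upd: "(\<lambda>x. (snd (fst x))(n := snd x)) \<in> (states G \<Otimes>\<^sub>M PiM {0..<n} (\<lambda>_. steps G)) \<Otimes>\<^sub>M steps G
        \<rightarrow>\<^sub>M PiM {0..<Suc n} (\<lambda>_. steps G)"
      by (rule measurable_fun_upd[where J = "{0..<n}"]) auto
    have "(\<lambda>x. distr (step_kernel G \<pi> (fst x) n (snd x)) (PiM {0..<Suc n} (\<lambda>_. steps G)) (fun_upd (snd x) n))
        \<in> states G \<Otimes>\<^sub>M PiM {0..<n} (\<lambda>_. steps G) \<rightarrow>\<^sub>M prob_algebra (PiM {0..<Suc n} (\<lambda>_. steps G))"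
      by (rule measurable_distr_prob_space2[OF measurable_step_kernel[OF assms]])
         (use upd in \<open>simp add: case_prod_beta\<close>)
    then show "(\<lambda>(s, \<omega>). distr (step_kernel G \<pi> s n \<omega>) (PiM {0..<Suc n} (\<lambda>_. steps G)) (fun_upd \<omega> n))
        \<in> states G \<Otimes>\<^sub>M PiM {0..<n} (\<lambda>_. steps G) \<rightarrow>\<^sub>M prob_algebra (PiM {0..<Suc n} (\<lambda>_. steps G))"
      by (simp add: case_prod_beta)
  qed
  ultimately show ?case
    by (simp cong: measurable_cong)
qed

text \<open>The Ionescu-Tulcea limit extends the finite-dimensional laws, and each of these comes
  from any prefix long enough to contain the times in \<open>J\<close>.\<close>

lemma emeasure_trajectory:
  fixes G :: "('n::finite, 'g, 's, 'a) gmdp"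
  assumes "is_gmdp G" "is_policy G \<pi>" "s \<in> space (states G)"
    and J: "J \<subseteq> {0..<n}" and X: "X \<in> sets (PiM J (\<lambda>_. steps G))"
  shows "emeasure (trajectory G \<pi> s) (prod_emb UNIV (\<lambda>_. steps G) J X) =
    emeasure (Ionescu_Tulcea.C (step_kernel G \<pi> s) (\<lambda>_. steps G) 0 n (\<lambda>_. undefined))
      (prod_emb {0..<n} (\<lambda>_. steps G) J X)"
proof -
  interpret Ionescu_Tulcea "step_kernel G \<pi> s" "\<lambda>_. steps G"
    by (rule Ionescu_Tulcea_step_kernel[OF assms(1-3)])
  show ?thesis
    unfolding trajectory_def using lim[OF finite_subset[OF J] X] emeasure_CI[OF J X] by simp
qed

text \<open>Cylinders generate the product sigma-algebra and are closed under intersection; a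
  cylinder sees only a finite prefix, whose law is already measurable in the start state.\<close>

lemma measurable_trajectory:
  fixes G :: "('n::finite, 'g, 's, 'a) gmdp"
  assumes "is_gmdp G" "is_policy G \<pi>"
  shows "trajectory G \<pi> \<in> states G \<rightarrow>\<^sub>M prob_algebra (PiM UNIV (\<lambda>_. steps G))"
proof (rule measurable_prob_algebra_generated[OF sets_PiM Int_stable_prod_algebra prod_algebra_sets_into_space])
  fix s assume s: "s \<in> space (states G)"
  interpret Ionescu_Tulcea "step_kernel G \<pi> s" "\<lambda>_. steps G"
    by (rule Ionescu_Tulcea_step_kernel[OF assms s])
  show "sets (trajectory G \<pi> s) = sets (PiM UNIV (\<lambda>_. steps G))"
    unfolding trajectory_def by simp
  \<comment> \<open>Total mass 1 is read off the cylinder over no time at all: its base is a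
    one-point space, and it fills the whole trajectory space.\<close>
  have emb: "prod_emb UNIV (\<lambda>_. steps G) {} {\<lambda>_. undefined} = space (PiM UNIV (\<lambda>_. steps G))"
    by (auto simp: prod_emb_def space_PiM)
  have "prob_space (CI {})"
    by (rule PF.prob_space_P) auto
  then have "emeasure (CI {}) {\<lambda>_. undefined} = 1"
    using prob_space.emeasure_space_1[of "CI {}"] by (simp add: PF.space_P space_PiM)
  then show "prob_space (trajectory G \<pi> s)"
    using lim[of "{}" "{\<lambda>_. undefined}"] unfolding emb trajectory_def
    by (intro prob_spaceI) (simp add: sets_PiM_empty)
next
  fix A assume "A \<in> prod_algebra (UNIV :: nat set) (\<lambda>_. steps G)"
  then obtain J E where A: "A = prod_emb UNIV (\<lambda>_. steps G) J (Pi\<^sub>E J E)" and "finite J"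
    and E: "\<And>i. i \<in> J \<Longrightarrow> E i \<in> sets (steps G)"
    by (elim prod_algebraE) auto
  obtain n where J: "J \<subseteq> {0..<n}"
    using \<open>finite J\<close> by (auto simp: finite_nat_iff_bounded lessThan_atLeast0)
  have X: "Pi\<^sub>E J E \<in> sets (PiM J (\<lambda>_. steps G))"
    using \<open>finite J\<close> E by (intro sets_PiM_I_finite) auto
  have "(\<lambda>s. emeasure (Ionescu_Tulcea.C (step_kernel G \<pi> s) (\<lambda>_. steps G) 0 n (\<lambda>_. undefined))
      (prod_emb {0..<n} (\<lambda>_. steps G) J (Pi\<^sub>E J E))) \<in> borel_measurable (states G)"
    using J X by (intro measurable_emeasure_kernel[OF measurable_prob_algebraD[OF measurable_Ionescu_Tulcea_C]]
        measurable_prod_emb assms)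
  then show "(\<lambda>s. emeasure (trajectory G \<pi> s) A) \<in> borel_measurable (states G)"
    by (simp add: A emeasure_trajectory[OF assms _ J X] cong: measurable_cong)
qed

lemma
  fixes G :: "('n::finite, 'g, 's, 'a) gmdp"
  assumes "is_gmdp G" "is_policy G \<pi>" "s \<in> space (states G)"
  shows prob_space_trajectory: "prob_space (trajectory G \<pi> s)"
    and sets_trajectory: "sets (trajectory G \<pi> s) = sets (PiM UNIV (\<lambda>_. steps G))"
    and space_trajectory: "space (trajectory G \<pi> s) = space (PiM UNIV (\<lambda>_. steps G))"
  using measurable_space[OF measurable_trajectory[OF assms(1,2)] assms(3)]
  by (auto simp: space_prob_algebra intro!: sets_eq_imp_space_eq)

lemma measurable_state_at: "state_at t \<in> PiM UNIV (\<lambda>_. steps G) \<rightarrow>\<^sub>M states G"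
  unfolding state_at_def[abs_def] by measurable

text \<open>The event concerns time 0 only, so the law of the one-step prefix decides it. That
  prefix starts at \<open>s\<close> by the \<open>return\<close> in \<open>step_kernel\<close>, and
  the action drawn afterwards is projected away.\<close>

lemma distr_trajectory_state_at_0:
  fixes G :: "('n::finite, 'g, 's, 'a) gmdp"
  assumes G: "is_gmdp G" and \<pi>: "is_policy G \<pi>" and s: "s \<in> space (states G)"
  shows "distr (trajectory G \<pi> s) (states G) (state_at 0) = return (states G) s"
proof -
  interpret Ionescu_Tulcea "step_kernel G \<pi> s" "\<lambda>_. steps G"
    by (rule Ionescu_Tulcea_step_kernel[OF assms])
  \<comment> \<open>\<open>?u\<close> is the empty history, the only point of the product over
    \<open>{0..<0}\<close>.\<close>
  let ?u = "\<lambda>_::nat. undefined :: ('n, 'g, 's) state \<times> ('n \<Rightarrow> 'a)"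
  let ?K = "\<lambda>S. distr (joint_policy \<pi> 0 ?u S) (steps G) (Pair S)"
  have u: "?u \<in> space (PiM {0..<0} (\<lambda>_. steps G))"
    by (simp add: space_PiM)
  have "(\<lambda>S. (?u, S)) \<in> states G \<rightarrow>\<^sub>M PiM {0..<0} (\<lambda>_. steps G) \<Otimes>\<^sub>M states G"
    using u by measurable
  from measurable_compose[OF this measurable_joint_policy[OF \<pi>]]
  have jp: "joint_policy \<pi> 0 ?u \<in> states G \<rightarrow>\<^sub>M prob_algebra (actions G)"
    by simp
  then have K: "?K \<in> states G \<rightarrow>\<^sub>M prob_algebra (steps G)"
    by (rule measurable_distr_prob_space2) measurable
  have jps: "prob_space (joint_policy \<pi> 0 ?u s)" "sets (joint_policy \<pi> 0 ?u s) = sets (actions G)"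
    using measurable_space[OF jp s] by (auto simp: space_prob_algebra)
  have step: "step_kernel G \<pi> s 0 ?u = ?K s"
    unfolding step_kernel_def using bind_return[OF measurable_prob_algebraD[OF K] s] by simp
  have "emeasure (distr (trajectory G \<pi> s) (states G) (state_at 0)) A = emeasure (return (states G) s) A"
    if A: "A \<in> sets (states G)" for A
  proof -
    \<comment> \<open>The event is recast as a cylinder over \<open>{0}\<close>, which is the same
      index set as \<open>{0..<Suc 0}\<close>, so embedding it into the prefix space changes
      nothing.\<close>
    let ?X = "{\<omega>\<in>space (PiM {0::nat} (\<lambda>_. steps G)). fst (\<omega> 0) \<in> A}"
    have X: "?X \<in> sets (PiM {0} (\<lambda>_. steps G))"
      using A by measurable
    have "emeasure (distr (trajectory G \<pi> s) (states G) (state_at 0)) A =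
        emeasure (trajectory G \<pi> s) (state_at 0 -` A \<inter> space (PiM UNIV (\<lambda>_. steps G)))"
      using A measurable_state_at[of 0 G]
      by (subst emeasure_distr) (simp_all add: space_trajectory[OF assms] measurable_cong_sets[OF sets_trajectory[OF assms]])
    also have "state_at 0 -` A \<inter> space (PiM UNIV (\<lambda>_. steps G)) = prod_emb UNIV (\<lambda>_. steps G) {0} ?X"
      by (auto simp: prod_emb_def space_PiM state_at_def)
    also have "emeasure (trajectory G \<pi> s) \<dots> = emeasure (C 0 (Suc 0) ?u) (prod_emb {0..<Suc 0} (\<lambda>_. steps G) {0} ?X)"
      by (rule emeasure_trajectory[OF assms _ X]) simp
    also have "prod_emb {0..<Suc 0} (\<lambda>_. steps G) {0} ?X = ?X"
      using sets.sets_into_space[OF X] by (simp add: prod_emb_id space_PiM)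
    also have "C 0 (Suc 0) ?u = eP 0 ?u"
      using bind_return[OF measurable_eP u] by simp
    also have "emeasure (eP 0 ?u) ?X = emeasure (?K s) ((\<lambda>x. fun_upd ?u 0 x) -` ?X \<inter> space (steps G))"
      using emeasure_eP[OF u, of ?X] X by (simp add: step)
    \<comment> \<open>A single entry put into the empty history is a point of the one-coordinate
      product, so only the condition on the state component remains.\<close>
    also have "(\<lambda>x. fun_upd ?u 0 x) -` ?X \<inter> space (steps G) = fst -` A \<inter> space (steps G)"
      by (auto simp: space_PiM PiE_iff extensional_def)
    also have "emeasure (?K s) \<dots> = emeasure (distr (?K s) (states G) fst) A"
      using A by (simp add: emeasure_distr)
    also have "distr (?K s) (states G) fst = distr (joint_policy \<pi> 0 ?u s) (states G) (\<lambda>_. s)"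
      using s by (subst distr_distr) (auto simp: comp_def measurable_cong_sets[OF jps(2) refl])
    also have "\<dots> = return (states G) s"
      using jps(1) s by (simp add: prob_space.distr_const)
    finally show ?thesis .
  qed
  then show ?thesis
    by (intro measure_eqI) auto
qed

subsection \<open>Contractions of the space of bounded functions\<close>

lemma space_states_nonempty:
  assumes "is_gmdp G"
  shows "space (states G) \<noteq> {}"
proof -
  have "space (PiM UNIV (local_space G)) \<noteq> {}"
    using assms by (simp add: is_gmdp_def space_PiM_empty_iff)
  then show ?thesis
    using assms by (simp add: is_gmdp_def states_def space_pair_measure)
qed

lemma bounded_funsE:
  assumes "V \<in> bounded_funs G"
  obtains B where "\<And>S. S \<in> space (states G) \<Longrightarrow> norm1 (V S) \<le> B"
  using assms unfolding bounded_funs_def by blast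

lemma measurable_bounded_funs: "V \<in> bounded_funs G \<Longrightarrow> V \<in> borel_measurable (states G)"
  by (simp add: bounded_funs_def)

lemma restrict_mem_bounded_funs:
  assumes "f \<in> borel_measurable (states G)" "\<And>S. S \<in> space (states G) \<Longrightarrow> norm1 (f S) \<le> B"
  shows "restrict f (space (states G)) \<in> bounded_funs G"
proof -
  have "restrict f (space (states G)) \<in> borel_measurable (states G)"
    using assms(1) by (simp cong: measurable_cong)
  then show ?thesis
    using assms(2) unfolding bounded_funs_def by fastforce
qed

text \<open>A supremum of reals is known to dominate the members of a set that is bounded above; the
  bounds of \<open>V\<close> and \<open>W\<close> add up to such a bound.\<close>

lemma norm1_diff_le_sup_norm:
  assumes "V \<in> bounded_funs G" "W \<in> bounded_funs G" "S \<in> space (states G)"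
  shows "norm1 (V S - W S) \<le> sup_norm G (\<lambda>S. V S - W S)"
proof -
  obtain A where A: "\<And>S. S \<in> space (states G) \<Longrightarrow> norm1 (V S) \<le> A"
    using assms(1) bounded_funsE by blast
  obtain B where B: "\<And>S. S \<in> space (states G) \<Longrightarrow> norm1 (W S) \<le> B"
    using assms(2) bounded_funsE by blast
  have "norm1 (V S - W S) \<le> A + B" if "S \<in> space (states G)" for S
    using norm1_diff_triangle[of "V S" "W S" 0] A[OF that] B[OF that]
      norm1_minus_commute[of 0 "W S"]
    by simp
  then show ?thesis
    unfolding sup_norm_def using assms(3) by (intro cSUP_upper bdd_aboveI2) auto
qed

text \<open>Nonemptiness of the state space makes the real supremum a least upper bound.\<close>

lemma sup_norm_le:
  assumes "is_gmdp G" "\<And>S. S \<in> space (states G) \<Longrightarrow> norm1 (f S) \<le> b"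
  shows "sup_norm G f \<le> b"
  unfolding sup_norm_def using assms space_states_nonempty by (intro cSUP_least) auto

text \<open>The supremum controls values on the state space; off it, extensionality makes both
  functions \<open>undefined\<close>.\<close>

lemma bounded_funs_eqI:
  assumes "V \<in> bounded_funs G" "W \<in> bounded_funs G" "sup_norm G (\<lambda>S. V S - W S) \<le> 0"
  shows "V = W"
proof (rule extensionalityI[of _ "space (states G)"])
  fix S assume "S \<in> space (states G)"
  then have "norm1 (V S - W S) = 0"
    by (intro antisym order_trans[OF norm1_diff_le_sup_norm[OF assms(1,2)] assms(3)] norm1_nonneg)
  then show "V S = W S"
    by (simp add: norm1_eq_0_iff)
qed (use assms in \<open>auto simp: bounded_funs_def\<close>)

text \<open>Banach's fixed point theorem. The iterates have geometrically decreasing increments, so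
  they converge pointwise at a uniform rate; the limit stays measurable and bounded, and the rate
  shows that \<open>T\<close> fixes it.\<close>

lemma sup_norm_contraction_fixed_point:
  fixes G :: "('n::finite, 'g, 's, 'a) gmdp"
    and T :: "(('n, 'g, 's) state \<Rightarrow> real ^ 'n) \<Rightarrow> ('n, 'g, 's) state \<Rightarrow> real ^ 'n"
  assumes G: "is_gmdp G" and c: "0 \<le> c" "c < 1"
    and T: "\<And>V. V \<in> bounded_funs G \<Longrightarrow> T V \<in> bounded_funs G"
    and contr: "\<And>V W. V \<in> bounded_funs G \<Longrightarrow> W \<in> bounded_funs G \<Longrightarrow>
      sup_norm G (\<lambda>S. T V S - T W S) \<le> c * sup_norm G (\<lambda>S. V S - W S)"
  shows "\<exists>!V. V \<in> bounded_funs G \<and> T V = V"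
proof (rule ex_ex1I)
  \<comment> \<open>Starting at zero lets the error estimate at \<open>k = 0\<close> serve as the
    bound on the limit itself.\<close>
  define f where "f k = (T ^^ k) (\<lambda>S\<in>space (states G). 0)" for k
  have f: "f k \<in> bounded_funs G" for k
  proof (induction k)
    case 0
    show ?case
      unfolding f_def funpow_0 by (rule restrict_mem_bounded_funs[where B = 0]) auto
  qed (use T in \<open>simp add: f_def\<close>)
  have f_Suc: "f (Suc k) = T (f k)" for k
    by (simp add: f_def)
  define d where "d = sup_norm G (\<lambda>S. f 1 S - f 0 S)"
  have step: "sup_norm G (\<lambda>S. f (Suc k) S - f k S) \<le> c ^ k * d" for k
  proof (induction k)
    case (Suc k)
    have "sup_norm G (\<lambda>S. f (Suc (Suc k)) S - f (Suc k) S) \<le> c * sup_norm G (\<lambda>S. f (Suc k) S - f k S)"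
      using contr[OF f f, of "Suc k" k] by (simp add: f_Suc)
    also have "\<dots> \<le> c * (c ^ k * d)"
      by (intro mult_left_mono Suc c)
    finally show ?case by simp
  qed (simp add: d_def)
  have step_S: "norm1 (f (Suc k) S - f k S) \<le> c ^ k * d" if "S \<in> space (states G)" for k S
    using norm1_diff_le_sup_norm[OF f f that] step by (rule order_trans)
  have far: "norm1 (f (k + m) S - f k S) \<le> c ^ k * d * (\<Sum>j<m. c ^ j)"
    if S: "S \<in> space (states G)" for k m S
  proof (induction m)
    case (Suc m)
    have "norm1 (f (k + Suc m) S - f k S) \<le> norm1 (f (Suc (k + m)) S - f (k + m) S) + norm1 (f (k + m) S - f k S)"
      using norm1_diff_triangle[of "f (k + Suc m) S" "f k S" "f (k + m) S"] by simp
    then show ?case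
      using Suc step_S[OF S, of "k + m"] by (simp add: algebra_simps power_add)
  qed simp
  have d: "0 \<le> d"
  proof -
    obtain S where "S \<in> space (states G)"
      using space_states_nonempty[OF G] by auto
    from norm1_diff_le_sup_norm[OF f f this] show ?thesis
      unfolding d_def by (rule order_trans[OF norm1_nonneg])
  qed
  have geom: "(\<Sum>j<m. c ^ j) \<le> 1 / (1 - c)" for m
  proof -
    have "summable (\<lambda>j. c ^ j)" "(\<Sum>j. c ^ j) = 1 / (1 - c)"
      using c by (auto intro!: summable_geometric suminf_geometric)
    then show ?thesis
      using sum_le_suminf[of "\<lambda>j. c ^ j" "{..<m}"] c by simp
  qed
  \<comment> \<open>\<open>K\<close> is the whole geometric series of increment bounds, so
    \<open>c ^ k * K\<close> bounds the distance from \<open>f k\<close> to all later iterates,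
    uniformly in the state.\<close>
  define K where "K = d / (1 - c)"
  have far_K: "norm1 (f (k + m) S - f k S) \<le> c ^ k * K" if S: "S \<in> space (states G)" for k m S
  proof -
    have "c ^ k * d * (\<Sum>j<m. c ^ j) \<le> c ^ k * d * (1 / (1 - c))"
      using c d by (intro mult_left_mono geom) auto
    then show ?thesis
      using far[OF S, of k m] by (simp add: K_def)
  qed
  define U where "U S = lim (\<lambda>k. f k S)" for S
  have lim: "(\<lambda>k. f k S) \<longlonglongrightarrow> U S" if S: "S \<in> space (states G)" for S
  proof -
    have "summable (\<lambda>k. f (Suc k) S - f k S)"
    proof (rule summable_comparison_test)
      show "\<exists>N. \<forall>k\<ge>N. norm (f (Suc k) S - f k S) \<le> c ^ k * d"
        using order_trans[OF norm_le_norm1 step_S[OF S]] by blast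
      show "summable (\<lambda>k. c ^ k * d)"
        using c by (intro summable_mult2 summable_geometric) auto
    qed
    \<comment> \<open>These partial sums telescope to \<open>f n S - f 0 S\<close>.\<close>
    then have "convergent (\<lambda>n. \<Sum>k<n. f (Suc k) S - f k S)"
      by (simp add: summable_iff_convergent)
    then have "convergent (\<lambda>n. (f n S - f 0 S) + f 0 S)"
      unfolding sum_lessThan_telescope[of "\<lambda>k. f k S"] by (intro convergent_add convergent_const)
    then show ?thesis
      by (simp add: U_def convergent_LIMSEQ_iff)
  qed
  have close: "norm1 (U S - f k S) \<le> c ^ k * K" if S: "S \<in> space (states G)" for k S
  proof (rule LIMSEQ_le_const2)
    show "(\<lambda>m. norm1 (f (m + k) S - f k S)) \<longlonglongrightarrow> norm1 (U S - f k S)"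
      using LIMSEQ_ignore_initial_segment[OF lim[OF S], of k] by (intro tendsto_intros) auto
    show "\<exists>N. \<forall>m\<ge>N. norm1 (f (m + k) S - f k S) \<le> c ^ k * K"
      using far_K[OF S, of k] by (simp add: add.commute)
  qed
  \<comment> \<open>The restriction supplies the extensionality that membership in
    \<open>bounded_funs G\<close> demands.\<close>
  define V where "V = restrict U (space (states G))"
  have V: "V \<in> bounded_funs G"
    unfolding V_def
  proof (rule restrict_mem_bounded_funs)
    show "U \<in> borel_measurable (states G)"
      by (rule borel_measurable_LIMSEQ_metric[OF measurable_bounded_funs[OF f] lim])
    fix S assume S: "S \<in> space (states G)"
    show "norm1 (U S) \<le> K"
      using close[OF S, of 0] S by (simp add: f_def)
  qed
  have close': "sup_norm G (\<lambda>S. V S - f k S) \<le> c ^ k * K" for k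
    using close by (intro sup_norm_le G) (simp add: V_def)
  \<comment> \<open>Both \<open>T V\<close> and \<open>V\<close> lie within
    \<open>c ^ Suc k * K\<close> of \<open>f (Suc k)\<close>: the first by contracting the error at
    \<open>k\<close>, the second by the error at \<open>Suc k\<close>. This explains the factor
    2.\<close>
  have "sup_norm G (\<lambda>S. T V S - V S) \<le> 0"
  proof (rule LIMSEQ_le_const)
    show "(\<lambda>k. 2 * (c ^ Suc k * K)) \<longlonglongrightarrow> 0"
      using LIMSEQ_Suc[OF LIMSEQ_realpow_zero[OF c]]
      by (intro tendsto_mult_right_zero tendsto_mult_left_zero) simp
    have "sup_norm G (\<lambda>S. T V S - V S) \<le> 2 * (c ^ Suc k * K)" for k
    proof (rule sup_norm_le[OF G])
      fix S assume S: "S \<in> space (states G)"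
      have "norm1 (T V S - V S) \<le> norm1 (T V S - f (Suc k) S) + norm1 (f (Suc k) S - V S)"
        by (rule norm1_diff_triangle)
      also have "norm1 (T V S - f (Suc k) S) \<le> c * sup_norm G (\<lambda>S. V S - f k S)"
        using order_trans[OF norm1_diff_le_sup_norm[OF T[OF V] T[OF f] S] contr[OF V f]]
        by (simp add: f_Suc)
      also have "\<dots> \<le> c * (c ^ k * K)"
        by (intro mult_left_mono close' c)
      also have "norm1 (f (Suc k) S - V S) \<le> c ^ Suc k * K"
        using order_trans[OF norm1_diff_le_sup_norm[OF V f S] close', of "Suc k"]
        by (simp add: norm1_minus_commute)
      finally show "norm1 (T V S - V S) \<le> 2 * (c ^ Suc k * K)"
        by (simp add: ac_simps)
    qed
    then show "\<exists>N. \<forall>k\<ge>N. sup_norm G (\<lambda>S. T V S - V S) \<le> 2 * (c ^ Suc k * K)"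
      by blast
  qed
  then show "\<exists>V. V \<in> bounded_funs G \<and> T V = V"
    using bounded_funs_eqI[OF T[OF V] V] V by blast
next
  fix V W
  assume "V \<in> bounded_funs G \<and> T V = V" and "W \<in> bounded_funs G \<and> T W = W"
  then have V: "V \<in> bounded_funs G" "T V = V" and W: "W \<in> bounded_funs G" "T W = W"
    by auto
  have "(1 - c) * sup_norm G (\<lambda>S. V S - W S) \<le> 0"
    using contr[OF V(1) W(1)] V(2) W(2) by (simp add: algebra_simps)
  then have "sup_norm G (\<lambda>S. V S - W S) \<le> 0"
    using c by (simp add: mult_le_0_iff)
  then show "V = W"
    by (rule bounded_funs_eqI[OF V(1) W(1)])
qed

subsection \<open>The Bellman operator\<close>

context
  fixes G :: "('n::finite, 'g, 's, 'a) gmdp"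
    and \<pi> :: "('n, 's, 'a) policy"
    and \<gamma> C :: real
  assumes gmdp: "is_gmdp G"
    and policy: "is_policy G \<pi>"
    and reward_bound: "\<And>i x. x \<in> space (nbhd_space G i) \<Longrightarrow> \<bar>reward G i x\<bar> \<le> C"
    and discount: "0 < \<gamma>" "\<gamma> < 1"
begin

section \<open>Bounds, measurability and integrability along trajectories\<close>

lemma self_loop: "(i, i) \<in> edges G"
  using gmdp by (simp add: is_gmdp_def)

lemma norm1_reward_at_le:
  assumes "\<omega> \<in> space (PiM UNIV (\<lambda>_. steps G))"
  shows "norm1 (reward_at G t \<omega>) \<le> CARD('n) * C"
proof -
  have "\<omega> t \<in> space (steps G)"
    using assms by (auto simp: space_PiM)
  then have "\<bar>reward_at G t \<omega> $ i\<bar> \<le> C" for i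
    using measurable_space[OF measurable_nbhd_view, of "\<omega> t" G i]
    by (simp add: reward_at_def reward_vec_def reward_bound)
  then show ?thesis
    unfolding norm1_def using sum_bounded_above[of UNIV "\<lambda>i. \<bar>reward_at G t \<omega> $ i\<bar>" C] by simp
qed

lemma measurable_reward_at: "reward_at G t \<in> borel_measurable (PiM UNIV (\<lambda>_. steps G))"
  unfolding reward_at_def[abs_def]
  by (rule measurable_compose[OF _ measurable_reward_vec[OF gmdp]]) simp

lemma measurable_value_at:
  "V \<in> bounded_funs G \<Longrightarrow> (\<lambda>\<omega>. V (state_at t \<omega>)) \<in> borel_measurable (PiM UNIV (\<lambda>_. steps G))"
  by (rule measurable_compose[OF measurable_state_at measurable_bounded_funs])

lemma state_at_in_space:
  "\<omega> \<in> space (PiM UNIV (\<lambda>_. steps G)) \<Longrightarrow> state_at t \<omega> \<in> space (states G)"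
  by (rule measurable_space[OF measurable_state_at])

lemma measurable_trajectory_cong:
  "S \<in> space (states G) \<Longrightarrow> measurable (trajectory G \<pi> S) N = measurable (PiM UNIV (\<lambda>_. steps G)) N"
  by (rule measurable_cong_sets[OF sets_trajectory[OF gmdp policy] refl])

lemma
  assumes S: "S \<in> space (states G)"
  shows integrable_reward_at: "integrable (trajectory G \<pi> S) (reward_at G t)"
    and integrable_value_at: "V \<in> bounded_funs G \<Longrightarrow> integrable (trajectory G \<pi> S) (\<lambda>\<omega>. V (state_at t \<omega>))"
proof -
  interpret prob_space "trajectory G \<pi> S"
    by (rule prob_space_trajectory[OF gmdp policy S])
  note space = space_trajectory[OF gmdp policy S]
  show "integrable (trajectory G \<pi> S) (reward_at G t)"
    using norm1_reward_at_le measurable_reward_at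
    by (intro integrable_norm1_bounded[of _ "CARD('n) * C"]) (auto simp: space measurable_trajectory_cong[OF S])
  assume V: "V \<in> bounded_funs G"
  then obtain B where "\<And>S. S \<in> space (states G) \<Longrightarrow> norm1 (V S) \<le> B"
    using bounded_funsE by blast
  then show "integrable (trajectory G \<pi> S) (\<lambda>\<omega>. V (state_at t \<omega>))"
    using measurable_value_at[OF V] state_at_in_space
    by (intro integrable_norm1_bounded[of _ B]) (auto simp: space measurable_trajectory_cong[OF S])
qed

text \<open>Integrating a fixed measurable function against a kernel is measurable in the start
  state, and multiplication by \<Gamma> is continuous. The bound adds those of the rewards and of
  \<open>V\<close> and scales the sum by \<gamma>.\<close>

lemma bellman_bounded_funs:
  assumes V: "V \<in> bounded_funs G"
  shows "bellman G \<pi> \<gamma> V \<in> bounded_funs G"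
proof -
  obtain B where B: "\<And>S. S \<in> space (states G) \<Longrightarrow> norm1 (V S) \<le> B"
    using V bounded_funsE by blast
  let ?f = "\<lambda>\<omega>. reward_at G 0 \<omega> + V (state_at 1 \<omega>)"
  have f: "?f \<in> borel_measurable (PiM UNIV (\<lambda>_. steps G))"
    by (intro borel_measurable_add measurable_reward_at measurable_value_at V)
  have E: "(\<lambda>S. \<integral>\<omega>. ?f \<omega> \<partial>trajectory G \<pi> S) \<in> borel_measurable (states G)"
    by (rule measurable_compose[OF measurable_prob_algebraD[OF measurable_trajectory[OF gmdp policy]]
          integral_measurable_subprob_algebra[OF f]])
  have "(\<lambda>S. diffusion G \<gamma> *v (\<integral>\<omega>. ?f \<omega> \<partial>trajectory G \<pi> S)) \<in> borel_measurable (states G)"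
    by (rule borel_measurable_continuous_on[OF _ E])
       (rule linear_continuous_on[OF matrix_vector_mul_bounded_linear])
  moreover have "norm1 (diffusion G \<gamma> *v (\<integral>\<omega>. ?f \<omega> \<partial>trajectory G \<pi> S)) \<le> \<gamma> * (CARD('n) * C + B)"
    if S: "S \<in> space (states G)" for S
  proof -
    interpret prob_space "trajectory G \<pi> S"
      by (rule prob_space_trajectory[OF gmdp policy S])
    have "norm1 (\<integral>\<omega>. ?f \<omega> \<partial>trajectory G \<pi> S) \<le> CARD('n) * C + B"
    proof (rule norm1_expectation_le)
      show "?f \<in> borel_measurable (trajectory G \<pi> S)"
        using f by (simp add: measurable_trajectory_cong[OF S])
      show "norm1 (?f \<omega>) \<le> CARD('n) * C + B" if "\<omega> \<in> space (trajectory G \<pi> S)" for \<omega>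
        using that unfolding space_trajectory[OF gmdp policy S]
        by (intro order_trans[OF norm1_triangle] add_mono norm1_reward_at_le B state_at_in_space)
    qed
    then show ?thesis
      using norm1_diffusion_le[OF self_loop less_imp_le[OF discount(1)]] discount(1)
      by (meson mult_left_mono less_imp_le order_trans)
  qed
  ultimately show ?thesis
    unfolding bellman_def by (rule restrict_mem_bounded_funs)
qed

text \<open>The rewards cancel in the difference, leaving \<Gamma> applied to an expected difference
  of values: the expectation is at most the supremum norm, and \<Gamma> contributes the factor
  \<gamma>.\<close>

lemma bellman_contraction:
  assumes V: "V \<in> bounded_funs G" and W: "W \<in> bounded_funs G"
  shows "sup_norm G (\<lambda>S. bellman G \<pi> \<gamma> V S - bellman G \<pi> \<gamma> W S) \<le> \<gamma> * sup_norm G (\<lambda>S. V S - W S)"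
proof (rule sup_norm_le[OF gmdp])
  fix S assume S: "S \<in> space (states G)"
  interpret prob_space "trajectory G \<pi> S"
    by (rule prob_space_trajectory[OF gmdp policy S])
  let ?d = "\<lambda>\<omega>. V (state_at 1 \<omega>) - W (state_at 1 \<omega>)"
  have "bellman G \<pi> \<gamma> V S - bellman G \<pi> \<gamma> W S = diffusion G \<gamma> *v (\<integral>\<omega>. ?d \<omega> \<partial>trajectory G \<pi> S)"
    using S by (simp add: bellman_def matrix_vector_mult_diff_distrib[symmetric]
        integrable_reward_at integrable_value_at V W)
  also have "norm1 \<dots> \<le> \<gamma> * norm1 (\<integral>\<omega>. ?d \<omega> \<partial>trajectory G \<pi> S)"
    by (rule norm1_diffusion_le[OF self_loop less_imp_le[OF discount(1)]])
  also have "\<dots> \<le> \<gamma> * sup_norm G (\<lambda>S. V S - W S)"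
  proof (intro mult_left_mono norm1_expectation_le)
    show "?d \<in> borel_measurable (trajectory G \<pi> S)"
      using measurable_value_at[OF V] measurable_value_at[OF W] by (simp add: measurable_trajectory_cong[OF S])
    show "norm1 (?d \<omega>) \<le> sup_norm G (\<lambda>S. V S - W S)" if "\<omega> \<in> space (trajectory G \<pi> S)" for \<omega>
      using that unfolding space_trajectory[OF gmdp policy S]
      by (intro norm1_diff_le_sup_norm V W state_at_in_space)
  qed (use discount in simp)
  finally show "norm1 (bellman G \<pi> \<gamma> V S - bellman G \<pi> \<gamma> W S) \<le> \<gamma> * sup_norm G (\<lambda>S. V S - W S)" .
qed

section \<open>Identification of the fixed point with the diffusion value function\<close>

lemma expected_value_recursion:
  assumes V: "V \<in> bounded_funs G" "bellman G \<pi> \<gamma> V = V" and all_times: "bellman_at_all_times G \<pi> \<gamma>"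
    and S: "S \<in> space (states G)"
  shows "(\<integral>\<omega>. V (state_at t \<omega>) \<partial>trajectory G \<pi> S) =
    diffusion G \<gamma> *v ((\<integral>\<omega>. reward_at G t \<omega> \<partial>trajectory G \<pi> S) + (\<integral>\<omega>. V (state_at (Suc t) \<omega>) \<partial>trajectory G \<pi> S))"
proof -
  let ?M = "trajectory G \<pi> S" and ?F = "state_algebra G \<pi> S t"
  let ?f = "\<lambda>\<omega>. reward_at G t \<omega> + V (state_at (Suc t) \<omega>)"
  let ?ce = "\<lambda>i. real_cond_exp ?M ?F (\<lambda>\<omega>. ?f \<omega> $ i)"
  interpret prob_space ?M
    by (rule prob_space_trajectory[OF gmdp policy S])
  have "state_at t \<in> ?M \<rightarrow>\<^sub>M states G"
    using measurable_state_at by (simp add: measurable_trajectory_cong[OF S])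
  \<comment> \<open>Preimages of measurable sets of states under the measurable map
    \<open>state_at t\<close> are events, so conditioning on the state at time \<open>t\<close> is
    legitimate.\<close>
  then have "subalgebra ?M ?F"
    unfolding subalgebra_def state_algebra_def
    by (auto simp: sets_vimage_algebra2[OF funcsetI] measurable_space measurable_sets)
  then interpret finite_measure_subalgebra ?M ?F
    by unfold_locales
  have f: "integrable ?M ?f"
    by (intro Bochner_Integration.integrable_add integrable_reward_at integrable_value_at V S)
  have fi: "integrable ?M (\<lambda>\<omega>. ?f \<omega> $ i)" for i
    by (rule integrable_vec_nth[OF f])
  have ce: "integrable ?M (\<lambda>\<omega>. \<chi> i. ?ce i \<omega>)"
    by (intro integrable_vec_lambda real_cond_exp_int(1) fi)
  \<comment> \<open>The tower property in each coordinate: conditioning preserves the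
    expectation.\<close>
  have E: "(\<integral>\<omega>. (\<chi> i. ?ce i \<omega>) \<partial>?M) = (\<integral>\<omega>. ?f \<omega> \<partial>?M)"
    by (simp only: vec_eq_iff integral_vec_nth[OF ce] integral_vec_nth[OF f] vec_lambda_beta
        real_cond_exp_int(2)[OF fi]) simp
  \<comment> \<open>This is the Bellman equation at time \<open>t\<close> for the process started in
    \<open>S\<close>; the fixed point equation has turned \<open>bellman G \<pi> \<gamma> V\<close>
    into \<open>V\<close>.\<close>
  have "AE \<omega> in ?M. V (state_at t \<omega>) = diffusion G \<gamma> *v (\<chi> i. ?ce i \<omega>)"
    using all_times S V unfolding bellman_at_all_times_def by fastforce
  then have "(\<integral>\<omega>. V (state_at t \<omega>) \<partial>?M) = (\<integral>\<omega>. diffusion G \<gamma> *v (\<chi> i. ?ce i \<omega>) \<partial>?M)"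
    using borel_measurable_integrable[OF integrable_value_at[OF S V(1)]]
      borel_measurable_integrable[OF integrable_bounded_linear[OF matrix_vector_mul_bounded_linear ce]]
    by (intro integral_cong_AE)
  also have "\<dots> = diffusion G \<gamma> *v (\<integral>\<omega>. ?f \<omega> \<partial>?M)"
    by (simp only: integral_matrix_vector_mult[OF ce] E)
  finally show ?thesis
    by (simp add: integrable_reward_at integrable_value_at V S)
qed

text \<open>The expectations of the partial sums \<open>R n\<close> have two limits that must agree:
  unrolling the recursion yields \<open>V S\<close>, and dominated convergence yields the diffusion
  value.\<close>

lemma fixed_point_eq_diffusion_value:
  assumes V: "V \<in> bounded_funs G" "bellman G \<pi> \<gamma> V = V" and all_times: "bellman_at_all_times G \<pi> \<gamma>"
  shows "V = diffusion_value G \<pi> \<gamma>"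
proof (rule extensionalityI[of _ "space (states G)"])
  fix S assume S: "S \<in> space (states G)"
  let ?M = "trajectory G \<pi> S" and ?\<Gamma> = "diffusion G \<gamma>"
  interpret prob_space ?M
    by (rule prob_space_trajectory[OF gmdp policy S])
  note space = space_trajectory[OF gmdp policy S]
  note pow_le = norm1_mat_pow_diffusion_le[OF self_loop less_imp_le[OF discount(1)]]
  obtain B where B: "\<And>S. S \<in> space (states G) \<Longrightarrow> norm1 (V S) \<le> B"
    using V(1) bounded_funsE by blast
  define r where "r t = (\<integral>\<omega>. reward_at G t \<omega> \<partial>?M)" for t
  define v where "v t = (\<integral>\<omega>. V (state_at t \<omega>) \<partial>?M)" for t
  define R where "R n \<omega> = (\<Sum>t<n. mat_pow ?\<Gamma> (t + 1) *v reward_at G t \<omega>)" for n \<omega>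

  \<comment> \<open>The law of the state at time 0 is the Dirac measure at \<open>S\<close>, so the
    expectation is a point value.\<close>
  have v0: "v 0 = V S"
  proof -
    have "v 0 = (\<integral>S. V S \<partial>distr ?M (states G) (state_at 0))"
      unfolding v_def using measurable_state_at measurable_bounded_funs[OF V(1)]
      by (subst integral_distr) (auto simp: measurable_trajectory_cong[OF S])
    also have "\<dots> = V S"
      unfolding distr_trajectory_state_at_0[OF gmdp policy S]
      using measurable_bounded_funs[OF V(1)] S by (simp add: integral_return)
    finally show ?thesis .
  qed
  have telescope: "v 0 = (\<Sum>t<n. mat_pow ?\<Gamma> (t + 1) *v r t) + mat_pow ?\<Gamma> n *v v n" for n
  proof (induction n)
    case (Suc n)
    have "v n = ?\<Gamma> *v (r n + v (Suc n))"
      unfolding v_def r_def by (rule expected_value_recursion[OF V all_times S])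
    \<comment> \<open>The new factor \<Gamma> stands to the right of the power; commutation absorbs
      it into \<open>mat_pow ?\<Gamma> (Suc n)\<close>.\<close>
    then have "mat_pow ?\<Gamma> n *v v n = mat_pow ?\<Gamma> (Suc n) *v (r n + v (Suc n))"
      by (simp add: matrix_vector_mul_assoc mat_pow_commute)
    then show ?case
      using Suc by (simp add: matrix_vector_right_distrib del: mat_pow.simps)
  qed simp
  \<comment> \<open>The expectations \<open>v n\<close> inherit the bound \<open>B\<close> of
    \<open>V\<close>, while the matrix power shrinks the 1-norm by
    \<open>\<gamma> ^ n\<close>.\<close>
  have "(\<lambda>n. mat_pow ?\<Gamma> n *v v n) \<longlonglongrightarrow> 0"
  proof (rule Lim_null_comparison)
    have "norm1 (v n) \<le> B" for n
      unfolding v_def using measurable_value_at[OF V(1)]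
      by (intro norm1_expectation_le) (auto simp: measurable_trajectory_cong[OF S] space B state_at_in_space)
    then have "norm (mat_pow ?\<Gamma> n *v v n) \<le> \<gamma> ^ n * B" for n
      using discount by (intro order_trans[OF norm_le_norm1] order_trans[OF pow_le] mult_left_mono) auto
    then show "\<forall>\<^sub>F n in sequentially. norm (mat_pow ?\<Gamma> n *v v n) \<le> \<gamma> ^ n * B"
      by simp
    show "(\<lambda>n. \<gamma> ^ n * B) \<longlonglongrightarrow> 0"
      using discount by (intro tendsto_mult_left_zero LIMSEQ_realpow_zero) auto
  qed
  then have "(\<lambda>n. v 0 - mat_pow ?\<Gamma> n *v v n) \<longlonglongrightarrow> v 0 - 0"
    by (intro tendsto_intros)
  moreover have "v 0 - mat_pow ?\<Gamma> n *v v n = (\<integral>\<omega>. R n \<omega> \<partial>?M)" for n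
  proof -
    have "integrable ?M (\<lambda>\<omega>. mat_pow ?\<Gamma> (t + 1) *v reward_at G t \<omega>)" for t
      by (rule integrable_bounded_linear[OF matrix_vector_mul_bounded_linear integrable_reward_at[OF S]])
    then show ?thesis
      using telescope[of n]
      by (simp add: R_def r_def integral_matrix_vector_mult[OF integrable_reward_at[OF S]] del: mat_pow.simps)
  qed
  ultimately have "(\<lambda>n. \<integral>\<omega>. R n \<omega> \<partial>?M) \<longlonglongrightarrow> V S"
    by (simp add: v0)
  \<comment> \<open>The majorant is a constant, the sum of the geometric term bounds
    \<open>\<gamma> ^ (t + 1) * ?C\<close>; it is integrable because the trajectory law is a
    probability measure.\<close>
  moreover have "(\<lambda>n. \<integral>\<omega>. R n \<omega> \<partial>?M) \<longlonglongrightarrow> (\<integral>\<omega>. (\<Sum>t. mat_pow ?\<Gamma> (t + 1) *v reward_at G t \<omega>) \<partial>?M)"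
  proof (rule integral_dominated_convergence)
    let ?C = "CARD('n) * C"
    have term_le: "norm (mat_pow ?\<Gamma> (t + 1) *v reward_at G t \<omega>) \<le> \<gamma> ^ (t + 1) * ?C"
      if "\<omega> \<in> space ?M" for t \<omega>
      using discount norm1_reward_at_le[of \<omega> t] that
      by (intro order_trans[OF norm_le_norm1] order_trans[OF pow_le] mult_left_mono) (auto simp: space)
    have summable: "summable (\<lambda>t. \<gamma> ^ (t + 1) * ?C)"
      using discount by (simp add: summable_mult summable_mult2 summable_geometric)
    have R: "R n \<in> borel_measurable ?M" for n
      unfolding R_def
      by (intro borel_measurable_sum borel_measurable_integrable
          integrable_bounded_linear[OF matrix_vector_mul_bounded_linear integrable_reward_at[OF S]])
    then show "R n \<in> borel_measurable ?M" for n .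
    have lim: "(\<lambda>n. R n \<omega>) \<longlonglongrightarrow> (\<Sum>t. mat_pow ?\<Gamma> (t + 1) *v reward_at G t \<omega>)" if "\<omega> \<in> space ?M" for \<omega>
      unfolding R_def using term_le[OF that]
      by (intro summable_LIMSEQ summable_comparison_test[OF _ summable]) blast
    then show "AE \<omega> in ?M. (\<lambda>n. R n \<omega>) \<longlonglongrightarrow> (\<Sum>t. mat_pow ?\<Gamma> (t + 1) *v reward_at G t \<omega>)"
      by (rule AE_I2)
    \<comment> \<open>The series is measurable as the pointwise limit of its measurable partial
      sums.\<close>
    show "(\<lambda>\<omega>. \<Sum>t. mat_pow ?\<Gamma> (t + 1) *v reward_at G t \<omega>) \<in> borel_measurable ?M"
      by (rule borel_measurable_LIMSEQ_metric[OF R lim])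
    have "norm (R n \<omega>) \<le> (\<Sum>t. \<gamma> ^ (t + 1) * ?C)" if \<omega>: "\<omega> \<in> space ?M" for n \<omega>
    proof -
      have "norm (R n \<omega>) \<le> (\<Sum>t<n. \<gamma> ^ (t + 1) * ?C)"
        unfolding R_def by (intro sum_norm_le term_le \<omega>)
      \<comment> \<open>Each term of the majorant is nonnegative because it bounds a norm at
        \<omega>, so the partial sum is at most the series.\<close>
      also have "\<dots> \<le> (\<Sum>t. \<gamma> ^ (t + 1) * ?C)"
        using order_trans[OF norm_ge_zero term_le[OF \<omega>]] by (intro sum_le_suminf summable) auto
      finally show ?thesis .
    qed
    then show "AE \<omega> in ?M. norm (R n \<omega>) \<le> (\<Sum>t. \<gamma> ^ (t + 1) * ?C)" for n
      by (intro AE_I2)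
    show "integrable ?M (\<lambda>_. \<Sum>t. \<gamma> ^ (t + 1) * ?C)"
      by simp
  qed
  ultimately have "V S = (\<integral>\<omega>. (\<Sum>t. mat_pow ?\<Gamma> (t + 1) *v reward_at G t \<omega>) \<partial>?M)"
    by (rule LIMSEQ_unique)
  then show "V S = diffusion_value G \<pi> \<gamma> S"
    using S by (simp add: diffusion_value_def)
qed (use V in \<open>auto simp: bounded_funs_def diffusion_value_def\<close>)

end

theorem proposition3p2:
  fixes G :: "('n::finite, 'g, 's, 'a) gmdp"
    and \<pi> :: "('n, 's, 'a) policy"
    and \<gamma> :: real
  assumes gmdp: "is_gmdp G"
    and policy: "is_policy G \<pi>"
    and bounded_rewards: "\<exists>B. \<forall>i. \<forall>x\<in>space (nbhd_space G i). \<bar>reward G i x\<bar> \<le> B"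
    and \<gamma>: "0 < \<gamma>" "\<gamma> < 1"
  shows "mat_norm1 (diffusion G \<gamma>) = Max (range (\<lambda>j. \<Sum>i\<in>UNIV. diffusion G \<gamma> $ i $ j)) \<and>
    Max (range (\<lambda>j. \<Sum>i\<in>UNIV. diffusion G \<gamma> $ i $ j)) = \<gamma> \<and>
    bellman G \<pi> \<gamma> ` bounded_funs G \<subseteq> bounded_funs G \<and>
    (\<forall>V\<in>bounded_funs G. \<forall>W\<in>bounded_funs G.
       sup_norm G (\<lambda>S. bellman G \<pi> \<gamma> V S - bellman G \<pi> \<gamma> W S) \<le> \<gamma> * sup_norm G (\<lambda>S. V S - W S)) \<and>
    (\<exists>!V. V \<in> bounded_funs G \<and> bellman G \<pi> \<gamma> V = V) \<and>
    (bellman_at_all_times G \<pi> \<gamma> \<longrightarrow>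
       diffusion_value G \<pi> \<gamma> \<in> bounded_funs G \<and>
       bellman G \<pi> \<gamma> (diffusion_value G \<pi> \<gamma>) = diffusion_value G \<pi> \<gamma>)"
proof -
  obtain C where C: "\<And>i x. x \<in> space (nbhd_space G i) \<Longrightarrow> \<bar>reward G i x\<bar> \<le> C"
    using bounded_rewards by blast
  have loop: "(i, i) \<in> edges G" for i
    using gmdp by (simp add: is_gmdp_def)
  have closed: "bellman G \<pi> \<gamma> V \<in> bounded_funs G" if "V \<in> bounded_funs G" for V
    by (rule bellman_bounded_funs[OF gmdp policy C \<gamma> that])
  have contraction: "sup_norm G (\<lambda>S. bellman G \<pi> \<gamma> V S - bellman G \<pi> \<gamma> W S) \<le> \<gamma> * sup_norm G (\<lambda>S. V S - W S)"
    if "V \<in> bounded_funs G" "W \<in> bounded_funs G" for V W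
    by (rule bellman_contraction[OF gmdp policy C \<gamma> that])
  have fixed_point: "\<exists>!V. V \<in> bounded_funs G \<and> bellman G \<pi> \<gamma> V = V"
    by (rule sup_norm_contraction_fixed_point[OF gmdp less_imp_le[OF \<gamma>(1)] \<gamma>(2) closed contraction])
  have "V = diffusion_value G \<pi> \<gamma>"
    if "V \<in> bounded_funs G" "bellman G \<pi> \<gamma> V = V" "bellman_at_all_times G \<pi> \<gamma>" for V
    by (rule fixed_point_eq_diffusion_value[OF gmdp policy C \<gamma> that])
  \<comment> \<open>The fixed point that exists is the diffusion value function, so its membership
    in \<open>bounded_funs G\<close> and its invariance carry over.\<close>
  with fixed_point have diffusion_value: "diffusion_value G \<pi> \<gamma> \<in> bounded_funs G \<and>
      bellman G \<pi> \<gamma> (diffusion_value G \<pi> \<gamma>) = diffusion_value G \<pi> \<gamma>"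
    if "bellman_at_all_times G \<pi> \<gamma>"
    using that by auto
  \<comment> \<open>Since the entries are nonnegative, the absolute values in the column sums drop
    out.\<close>
  have norm: "mat_norm1 (diffusion G \<gamma>) = Max (range (\<lambda>j. \<Sum>i\<in>UNIV. diffusion G \<gamma> $ i $ j))"
    using diffusion_nonneg[OF loop less_imp_le[OF \<gamma>(1)]] by (simp add: mat_norm1_eq_Max)
  have "Max (range (\<lambda>j. \<Sum>i\<in>UNIV. diffusion G \<gamma> $ i $ j)) = \<gamma>"
    by (simp add: diffusion_column_sum[OF loop])
  then show ?thesis
    using norm closed contraction fixed_point diffusion_value by (intro conjI ballI impI image_subsetI) simp_all
qed

end
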